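(* For every geodesic trajectory $\tau\in\mathcal{G}_{\mathrm{traj}}$ of four-dimensional Minkowski spacetime, the subspace $\mathcal{F}_\tau\subset T_\tau\mathcal{G}_{\mathrm{traj}}$ (the pushforward of the symplectic orthogonal to the reparametrization orbits) is the image of the canonical conformal co-symplectic structure $\sigma_\tau$: $$\mathcal{F}_\tau=\operatorname{Im}(\sigma_\tau).$$
   Context: Minkowski spacetime is $(M,g)=(\mathbf{R}^4,g)$, with $g$ the flat metric (constant bilinear form) of signature $(+,+,+,-)$. The space of parametrized geodesics $t\mapsto X+tV$ is the 8-dimensional manifold $\mathcal{G}_{\mathrm{curv}}=\mathbf{R}^4\times(\mathbf{R}^4\setminus\{0\})$, with points $\gamma=(X,V)$ and tangent vectors $\delta\gamma=(\delta X,\delta V)$. It carries the symplectic form $\omega_\gamma(\delta\gamma,\delta'\gamma)=g(\delta V,\delta'X)-g(\delta'V,\delta X)$. The group $\mathrm{Aff}^+(\mathbf{R})=\{(a,b): a>0,\ b\in\mathbf{R}\}$ of affine reparametrizations $t\mapsto at+b$ acts on $\mathcal{G}_{\mathrm{curv}}$ by $(a,b)\cdot(X,V)=(X+bV,\,aV)$. The action is free with 2-dimensional orbits $\mathcal{O}_\gamma$, and the quotient map $\pi:\mathcal{G}_{\mathrm{curv}}\to\mathcal{G}_{\mathrm{traj}}=\mathcal{G}_{\mathrm{curv}}/\mathrm{Aff}^+(\mathbf{R})$ is a principal bundle over the 6-dimensional manifold $\mathcal{G}_{\mathrm{traj}}$ of geodesic trajectories. Let $F_\gamma=\mathrm{Orth}_\omega(T_\gamma\mathcal{O}_\gamma)=\{\xi\in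 T_\gamma\mathcal{G}_{\mathrm{curv}}:\omega_\gamma(\xi,\eta)=0\ \text{for all}\ \eta\in T_\gamma\mathcal{O}_\gamma\}$ be the symplectic orthogonal to the tangent space of the orbit. The distribution $\mathcal{F}$ on $\mathcal{G}_{\mathrm{traj}}$ is $\mathcal{F}_\tau=D\pi_\gamma(F_\gamma)$, where $\tau=\pi(\gamma)$ (independent of the choice of $\gamma$ over $\tau$). The inverse $\omega^{-1}$ is the contravariant antisymmetric 2-tensor on $\mathcal{G}_{\mathrm{curv}}$ that, viewed as a map $\omega^{-1}_\gamma:T^*_\gamma\mathcal{G}_{\mathrm{curv}}\to T_\gamma\mathcal{G}_{\mathrm{curv}}$, is the inverse of the isomorphism defined by $\omega_\gamma$. Its conformal class $[\omega^{-1}]$ (its class up to positive scaling) is invariant under $\mathrm{Aff}^+(\mathbf{R})$. The canonical conformal co-symplectic structure is the field of rays of contravariant antisymmetric 2-tensors $\sigma:=\pi_*([\omega^{-1}])$ on $\mathcal{G}_{\mathrm{traj}}$: for $\tau=\pi(\gamma)$, $\sigma_\tau$ is the ray of positive multiples of $D\pi_\gamma\circ\omega^{-1}_\gamma\circ(D\pi_\gamma)^*:T^*_\tau\mathcal{G}_{\mathrm{traj}}\to T_\tau\mathcal{G}_{\mathrm{traj}}$, which does not depend on the choice of $\gamma$ over $\tau$. $\operatorname{Im}(\sigma_\tau)$ is the image of any representative of this ray. *)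

theory Defs
  imports "HOL-Analysis.Analysis"
begin

section \<open>Minkowski space and its parametrized geodesics\<close>

definition mink :: "real ^ 4 \<Rightarrow> real ^ 4 \<Rightarrow> real" where
  "mink x y = x $ 1 * y $ 1 + x $ 2 * y $ 2 + x $ 3 * y $ 3 - x $ 4 * y $ 4"

text \<open>The pair \<open>(X, V)\<close> stands for the geodesic \<open>t \<mapsto> X + t V\<close>. The space of parametrized geodesics
  is open in the vector space \<open>phase\<close>, which also serves as its tangent space at each point.\<close>

type_synonym phase = "(real ^ 4) \<times> (real ^ 4)"

definition G_curv :: "phase set" where
  "G_curv = {(X, V). V \<noteq> 0}"

fun omega :: "phase \<Rightarrow> phase \<Rightarrow> real" where
  "omega (dX, dV) (dX', dV') = mink dV dX' - mink dV' dX"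

section \<open>Affine reparametrizations and geodesic trajectories\<close>

definition Aff_pos :: "(real \<times> real) set" where
  "Aff_pos = {(a, b). a > 0}"

fun act :: "real \<times> real \<Rightarrow> phase \<Rightarrow> phase" where
  "act (a, b) (X, V) = (X + b *\<^sub>R V, a *\<^sub>R V)"

definition orbit :: "phase \<Rightarrow> phase set" where
  "orbit \<gamma> = (\<lambda>h. act h \<gamma>) ` Aff_pos"

typedef traj = "orbit ` G_curv"
  by (rule exI[of _ "orbit (0, 1)"]) (auto simp: G_curv_def)

text \<open>Only the values of \<open>proj\<close> on \<open>G_curv\<close> are meaningful.\<close>

definition proj :: "phase \<Rightarrow> traj" where
  "proj \<gamma> = Abs_traj (orbit \<gamma>)"

text \<open>Tangent space of the orbit at \<open>\<gamma>\<close>: the image of the differential at the identity \<open>(1, 0)\<close>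
  of the orbit map.\<close>

definition orbit_tangent :: "phase \<Rightarrow> phase set" where
  "orbit_tangent \<gamma> = range (frechet_derivative (\<lambda>h. act h \<gamma>) (at (1, 0)))"

definition F_curv :: "phase \<Rightarrow> phase set" where
  "F_curv \<gamma> = {\<xi>. \<forall>\<eta>\<in>orbit_tangent \<gamma>. omega \<xi> \<eta> = 0}"

section \<open>The quotient manifold and its tangent spaces\<close>

text \<open>\<open>Ck_on\<close> is only used for open \<open>S\<close>, where the total derivative is unique.\<close>

fun Ck_on :: "nat \<Rightarrow> ('a::euclidean_space \<Rightarrow> real) \<Rightarrow> 'a set \<Rightarrow> bool" where
  "Ck_on 0 f S \<longleftrightarrow> continuous_on S f"
| "Ck_on (Suc k) f S \<longleftrightarrow> (\<forall>x\<in>S. f differentiable (at x)) \<and>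
     (\<forall>v. Ck_on k (\<lambda>x. frechet_derivative f (at x) v) S)"

definition Cinf_on :: "('a::euclidean_space \<Rightarrow> real) \<Rightarrow> 'a set \<Rightarrow> bool" where
  "Cinf_on f S \<longleftrightarrow> (\<forall>k. Ck_on k f S)"

text \<open>As \<open>proj\<close> is a surjective submersion from \<open>G_curv\<close>, a function on the quotient manifold is smooth
  if and only if its pullback is.\<close>

definition smooth_traj :: "(traj \<Rightarrow> real) \<Rightarrow> bool" where
  "smooth_traj f \<longleftrightarrow> Cinf_on (f \<circ> proj) G_curv"

text \<open>Tangent vectors at \<open>\<tau>\<close> are the derivations at \<open>\<tau>\<close> of the algebra of smooth functions. They are
  extended by zero to non-smooth functions, so that equality of tangent vectors is equality in HOL.\<close>

definition tangent_space :: "traj \<Rightarrow> ((traj \<Rightarrow> real) \<Rightarrow> real) set" where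
  "tangent_space \<tau> = {D.
     (\<forall>f. \<not> smooth_traj f \<longrightarrow> D f = 0) \<and>
     (\<forall>f g. smooth_traj f \<longrightarrow> smooth_traj g \<longrightarrow> D (\<lambda>x. f x + g x) = D f + D g) \<and>
     (\<forall>c f. smooth_traj f \<longrightarrow> D (\<lambda>x. c * f x) = c * D f) \<and>
     (\<forall>f g. smooth_traj f \<longrightarrow> smooth_traj g \<longrightarrow> D (\<lambda>x. f x * g x) = f \<tau> * D g + g \<tau> * D f)}"

text \<open>Linear forms on the tangent space, extended by zero.\<close>

definition cotangent_space :: "traj \<Rightarrow> (((traj \<Rightarrow> real) \<Rightarrow> real) \<Rightarrow> real) set" where
  "cotangent_space \<tau> = {\<alpha>.
     (\<forall>D. D \<notin> tangent_space \<tau> \<longrightarrow> \<alpha> D = 0) \<and>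
     (\<forall>D\<in>tangent_space \<tau>. \<forall>E\<in>tangent_space \<tau>. \<alpha> (\<lambda>f. D f + E f) = \<alpha> D + \<alpha> E) \<and>
     (\<forall>c. \<forall>D\<in>tangent_space \<tau>. \<alpha> (\<lambda>f. c * D f) = c * \<alpha> D)}"

text \<open>The differential of \<open>proj\<close> at \<open>\<gamma>\<close>: the vector \<open>\<xi>\<close> is sent to the derivation
  \<open>f \<mapsto> \<xi> (f \<circ> proj)\<close>.\<close>

definition Dproj :: "phase \<Rightarrow> phase \<Rightarrow> (traj \<Rightarrow> real) \<Rightarrow> real" where
  "Dproj \<gamma> \<xi> = (\<lambda>f. if smooth_traj f then frechet_derivative (f \<circ> proj) (at \<gamma>) \<xi> else 0)"

section \<open>The distribution and the conformal co-symplectic structure\<close>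

text \<open>The images \<open>Dproj \<gamma> ` F_curv \<gamma>\<close> coincide for all \<open>\<gamma>\<close> over \<open>\<tau>\<close> (lemma \<open>F_traj_proj\<close>), so that the
  union over the fibre avoids choosing a representative.\<close>

definition F_traj :: "traj \<Rightarrow> ((traj \<Rightarrow> real) \<Rightarrow> real) set" where
  "F_traj \<tau> = (\<Union>\<gamma>\<in>{\<gamma> \<in> G_curv. proj \<gamma> = \<tau>}. Dproj \<gamma> ` F_curv \<gamma>)"

text \<open>\<open>omega_inv\<close> is meaningful on the linear forms on \<open>phase\<close>, cf. lemma \<open>bij_omega_flat\<close>.\<close>

definition omega_flat :: "phase \<Rightarrow> phase \<Rightarrow> real" where
  "omega_flat \<xi> = (\<lambda>\<eta>. omega \<xi> \<eta>)"

definition omega_inv :: "(phase \<Rightarrow> real) \<Rightarrow> phase" where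
  "omega_inv = inv_into UNIV omega_flat"

text \<open>The 2-tensor \<open>c (Dproj \<gamma> \<circ> omega_inv \<circ> (Dproj \<gamma>)\<^sup>*)\<close> as a map from the cotangent space to
  the tangent space.\<close>

definition push_tensor ::
  "phase \<Rightarrow> real \<Rightarrow> (((traj \<Rightarrow> real) \<Rightarrow> real) \<Rightarrow> real) \<Rightarrow> (traj \<Rightarrow> real) \<Rightarrow> real" where
  "push_tensor \<gamma> c = restrict (\<lambda>\<alpha> f. c * Dproj \<gamma> (omega_inv (\<alpha> \<circ> Dproj \<gamma>)) f)
     (cotangent_space (proj \<gamma>))"

text \<open>The union over the fibre is again a single ray, by lemma \<open>sigma_traj_proj\<close>.\<close>

definition sigma_traj ::
  "traj \<Rightarrow> ((((traj \<Rightarrow> real) \<Rightarrow> real) \<Rightarrow> real) \<Rightarrow> (traj \<Rightarrow> real) \<Rightarrow> real) set" where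
  "sigma_traj \<tau> = {push_tensor \<gamma> c | \<gamma> c. \<gamma> \<in> G_curv \<and> proj \<gamma> = \<tau> \<and> c > 0}"

section \<open>Well-definedness\<close>

lemma act_in_G_curv: "h \<in> Aff_pos \<Longrightarrow> \<gamma> \<in> G_curv \<Longrightarrow> act h \<gamma> \<in> G_curv"
  by (cases h; cases \<gamma>) (auto simp: Aff_pos_def G_curv_def)

lemma self_in_orbit: "\<gamma> \<in> orbit \<gamma>"
proof -
  have "\<gamma> = act (1, 0) \<gamma>" by (cases \<gamma>) simp
  moreover have "(1, 0) \<in> Aff_pos" by (simp add: Aff_pos_def)
  ultimately show ?thesis unfolding orbit_def by blast
qed

lemma act_act: "act (a, b) (act (a', b') \<gamma>) = act (a * a', b' + b * a') \<gamma>"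
  by (cases \<gamma>) (simp add: algebra_simps)

lemma orbit_act:
  assumes "h \<in> Aff_pos" shows "orbit (act h \<gamma>) = orbit \<gamma>"
proof -
  obtain a b where h: "h = (a, b)" by (cases h)
  have a: "a > 0" using assms h by (simp add: Aff_pos_def)
  show ?thesis
  proof
    show "orbit (act h \<gamma>) \<subseteq> orbit \<gamma>"
      using a by (auto simp: orbit_def h act_act Aff_pos_def intro!: image_eqI)
    show "orbit \<gamma> \<subseteq> orbit (act h \<gamma>)"
    proof
      fix x assume "x \<in> orbit \<gamma>"
      then obtain c d where cd: "c > 0" "x = act (c, d) \<gamma>" by (auto simp: orbit_def Aff_pos_def)
      have "x = act (c / a, (d - b) / a) (act h \<gamma>)"
        using a by (simp add: h act_act cd)
      moreover have "(c / a, (d - b) / a) \<in> Aff_pos" using a cd by (simp add: Aff_pos_def)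
      ultimately show "x \<in> orbit (act h \<gamma>)" unfolding orbit_def by blast
    qed
  qed
qed

lemma proj_act: "h \<in> Aff_pos \<Longrightarrow> proj (act h \<gamma>) = proj \<gamma>"
  by (simp add: proj_def orbit_act)

lemma proj_eq_iff:
  assumes "\<gamma> \<in> G_curv" "\<gamma>' \<in> G_curv"
  shows "proj \<gamma>' = proj \<gamma> \<longleftrightarrow> (\<exists>h\<in>Aff_pos. \<gamma>' = act h \<gamma>)"
proof
  assume "proj \<gamma>' = proj \<gamma>"
  then have "orbit \<gamma>' = orbit \<gamma>"
    using assms by (simp add: proj_def Abs_traj_inject)
  then show "\<exists>h\<in>Aff_pos. \<gamma>' = act h \<gamma>"
    using self_in_orbit[of \<gamma>'] by (auto simp: orbit_def)
qed (auto simp: proj_act)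

lemma ex_proj: "\<exists>\<gamma>\<in>G_curv. proj \<gamma> = \<tau>"
  by (cases \<tau>) (auto simp: proj_def)

lemma open_G_curv: "open G_curv"
proof -
  have "G_curv = UNIV \<times> (- {0})" by (auto simp: G_curv_def)
  moreover have "open ((UNIV :: (real ^ 4) set) \<times> (- {0 :: real ^ 4}))"
    by (intro open_Times) auto
  ultimately show ?thesis by metis
qed

lemma smooth_traj_differentiable:
  "smooth_traj f \<Longrightarrow> \<gamma> \<in> G_curv \<Longrightarrow> (f \<circ> proj) differentiable (at \<gamma>)"
  unfolding smooth_traj_def Cinf_on_def by (metis Ck_on.simps(2))

lemma orbit_tangent_eq: "orbit_tangent (X, V) = range (\<lambda>(s, t). (t *\<^sub>R V, s *\<^sub>R V))"
proof -
  have "(\<lambda>h. act h (X, V)) = (\<lambda>h. (X + snd h *\<^sub>R V, fst h *\<^sub>R V))"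
    by (intro ext) (metis act.simps prod.collapse)
  moreover have "((\<lambda>h. (X + snd h *\<^sub>R V, fst h *\<^sub>R V)) has_derivative
      (\<lambda>h. (snd h *\<^sub>R V, fst h *\<^sub>R V))) (at (1 :: real, 0 :: real))"
    by (auto intro!: derivative_eq_intros)
  ultimately have "((\<lambda>h. act h (X, V)) has_derivative (\<lambda>h. (snd h *\<^sub>R V, fst h *\<^sub>R V))) (at (1, 0))"
    by (simp only:)
  from frechet_derivative_at[OF this] show ?thesis
    unfolding orbit_tangent_def by (simp add: case_prod_unfold)
qed

lemma mink_scale [simp]: "mink (a *\<^sub>R x) y = a * mink x y" "mink x (a *\<^sub>R y) = a * mink x y"
  and mink_add: "mink (x + x') y = mink x y + mink x' y" "mink x (y + y') = mink x y + mink x y'"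
  and mink_sym: "mink x y = mink y x"
  by (simp_all add: mink_def algebra_simps)

lemma linear_act: "linear (act h)"
  by (rule linearI; cases h) (auto simp: algebra_simps)

lemma omega_act: "h = (a, b) \<Longrightarrow> omega (act h \<xi>) (act h \<eta>) = a * omega \<xi> \<eta>"
  by (cases \<xi>; cases \<eta>) (simp add: mink_add mink_sym algebra_simps)

lemma F_curv_act:
  assumes "h \<in> Aff_pos" "\<xi> \<in> F_curv \<gamma>"
  shows "act h \<xi> \<in> F_curv (act h \<gamma>)"
proof -
  obtain a b where h: "h = (a, b)" by (cases h)
  have a: "a > 0" using assms h by (simp add: Aff_pos_def)
  obtain X V where \<gamma>: "\<gamma> = (X, V)" by (cases \<gamma>)
  have "omega (act h \<xi>) \<eta> = 0" if \<eta>: "\<eta> \<in> orbit_tangent (act h \<gamma>)" for \<eta>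
  proof -
    obtain s t where st: "\<eta> = (t *\<^sub>R a *\<^sub>R V, s *\<^sub>R a *\<^sub>R V)"
      using \<eta> by (auto simp: \<gamma> h orbit_tangent_eq)
    define \<eta>' where "\<eta>' = ((t * a - b * s) *\<^sub>R V, s *\<^sub>R V)"
    have "\<eta> = act h \<eta>'"
      by (simp add: st h \<eta>'_def algebra_simps)
    moreover have "\<eta>' \<in> orbit_tangent \<gamma>"
      unfolding \<gamma> orbit_tangent_eq \<eta>'_def
      by (rule image_eqI[of _ _ "(s, t * a - b * s)"]) auto
    ultimately show ?thesis
      using assms(2) by (simp add: omega_act[OF h] F_curv_def)
  qed
  then show ?thesis by (simp add: F_curv_def)
qed

lemma Dproj_act:
  assumes "h \<in> Aff_pos" "\<gamma> \<in> G_curv"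
  shows "Dproj (act h \<gamma>) (act h \<xi>) = Dproj \<gamma> \<xi>"
proof
  fix f
  show "Dproj (act h \<gamma>) (act h \<xi>) f = Dproj \<gamma> \<xi> f"
  proof (cases "smooth_traj f")
    case True
    have "((f \<circ> proj) has_derivative frechet_derivative (f \<circ> proj) (at (act h \<gamma>))) (at (act h \<gamma>))"
      using smooth_traj_differentiable[OF True act_in_G_curv[OF assms]]
      by (simp add: frechet_derivative_works)
    moreover have "(act h has_derivative act h) (at \<gamma>)"
      by (simp add: linear_act linear_imp_has_derivative)
    ultimately have "((f \<circ> proj) \<circ> act h has_derivative
        frechet_derivative (f \<circ> proj) (at (act h \<gamma>)) \<circ> act h) (at \<gamma>)"
      using diff_chain_at by blast
    moreover have "(f \<circ> proj) \<circ> act h = f \<circ> proj"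
      using assms(1) by (auto simp: proj_act)
    ultimately have "frechet_derivative (f \<circ> proj) (at (act h \<gamma>)) \<circ> act h
        = frechet_derivative (f \<circ> proj) (at \<gamma>)"
      by (metis frechet_derivative_at)
    then show ?thesis
      using True by (simp add: Dproj_def o_def) (metis comp_apply)
  qed (simp add: Dproj_def)
qed

lemma Dproj_F_curv_act_subset:
  assumes "h \<in> Aff_pos" "\<gamma> \<in> G_curv"
  shows "Dproj \<gamma> ` F_curv \<gamma> \<subseteq> Dproj (act h \<gamma>) ` F_curv (act h \<gamma>)"
  using Dproj_act[OF assms] F_curv_act[OF assms(1)] by (metis image_eqI image_subsetI)

lemma F_traj_proj:
  assumes "\<gamma> \<in> G_curv"
  shows "F_traj (proj \<gamma>) = Dproj \<gamma> ` F_curv \<gamma>"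
proof -
  have "Dproj \<gamma>' ` F_curv \<gamma>' \<subseteq> Dproj \<gamma> ` F_curv \<gamma>"
    if \<gamma>': "\<gamma>' \<in> G_curv" "proj \<gamma>' = proj \<gamma>" for \<gamma>'
  proof -
    obtain h where "h \<in> Aff_pos" "\<gamma> = act h \<gamma>'"
      using proj_eq_iff[of \<gamma>' \<gamma>] \<gamma>' assms by metis
    then show ?thesis using Dproj_F_curv_act_subset \<gamma>' by simp
  qed
  then show ?thesis unfolding F_traj_def using assms by blast
qed

lemma bij_omega_flat: "bij_betw omega_flat UNIV {\<alpha>. linear \<alpha>}"
proof (rule bij_betwI')
  fix \<xi> \<eta> :: phase
  show "omega_flat \<xi> = omega_flat \<eta> \<longleftrightarrow> \<xi> = \<eta>"
  proof
    assume eq: "omega_flat \<xi> = omega_flat \<eta>"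
    obtain x v y w where s: "\<xi> = (x, v)" "\<eta> = (y, w)" by (cases \<xi>; cases \<eta>)
    have *: "omega (x, v) (z, u) = omega (y, w) (z, u)" for z u
      using fun_cong[OF eq, of "(z, u)"] by (simp add: omega_flat_def s)
    have "v $ 1 = w $ 1" "v $ 2 = w $ 2" "v $ 3 = w $ 3" "v $ 4 = w $ 4"
      using *[of "axis 1 1" 0] *[of "axis 2 1" 0] *[of "axis 3 1" 0] *[of "axis 4 1" 0]
      by (simp_all add: mink_def axis_def)
    moreover have "x $ 1 = y $ 1" "x $ 2 = y $ 2" "x $ 3 = y $ 3" "x $ 4 = y $ 4"
      using *[of 0 "axis 1 1"] *[of 0 "axis 2 1"] *[of 0 "axis 3 1"] *[of 0 "axis 4 1"]
      by (simp_all add: mink_def axis_def)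
    ultimately show "\<xi> = \<eta>" by (simp add: s vec_eq_iff forall_4)
  qed simp
next
  fix \<xi> :: phase
  show "omega_flat \<xi> \<in> {\<alpha>. linear \<alpha>}"
    by (cases \<xi>) (auto intro!: linearI simp: omega_flat_def mink_def algebra_simps)
next
  fix \<alpha> :: "phase \<Rightarrow> real" assume "\<alpha> \<in> {\<alpha>. linear \<alpha>}"
  then have lin: "linear \<alpha>" by simp
  define e :: "4 \<Rightarrow> real" where "e i = (if i = 4 then - 1 else 1)" for i
  define \<xi> :: phase where
    "\<xi> = ((\<chi> i. - e i * \<alpha> (0, axis i 1)), (\<chi> i. e i * \<alpha> (axis i 1, 0)))"
  have "\<alpha> (y, w) = omega \<xi> (y, w)" for y w
  proof -
    have y: "(\<Sum>i\<in>UNIV. y $ i *\<^sub>R axis i 1) = y" and w: "(\<Sum>i\<in>UNIV. w $ i *\<^sub>R axis i 1) = w"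
      using basis_expansion[of y] basis_expansion[of w] by (simp_all add: scalar_mult_eq_scaleR)
    have ly: "linear (\<lambda>y. \<alpha> (y, 0))" and lw: "linear (\<lambda>w. \<alpha> (0, w))"
      using linear_compose[OF _ lin, of "\<lambda>y. (y, 0)"] linear_compose[OF _ lin, of "\<lambda>w. (0, w)"]
      by (auto simp: o_def linear_iff)
    have "\<alpha> (y, 0) = (\<Sum>i\<in>UNIV. y $ i * \<alpha> (axis i 1, 0))"
      using linear_sum[OF ly, of "\<lambda>i. y $ i *\<^sub>R axis i 1" UNIV] by (simp add: y linear_scale[OF ly])
    moreover have "\<alpha> (0, w) = (\<Sum>i\<in>UNIV. w $ i * \<alpha> (0, axis i 1))"
      using linear_sum[OF lw, of "\<lambda>i. w $ i *\<^sub>R axis i 1" UNIV] by (simp add: w linear_scale[OF lw])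
    moreover have "\<alpha> (y, w) = \<alpha> (y, 0) + \<alpha> (0, w)"
      using linear_add[OF lin, of "(y, 0)" "(0, w)"] by simp
    ultimately show ?thesis
      by (simp add: \<xi>_def mink_def sum_4 e_def)
  qed
  then have "\<alpha> = omega_flat \<xi>"
    unfolding omega_flat_def by (intro ext) (metis surj_pair)
  then show "\<exists>\<xi>\<in>UNIV. \<alpha> = omega_flat \<xi>" by blast
qed

lemma Ck_on_cong:
  assumes "open S" "\<And>x. x \<in> S \<Longrightarrow> f x = g x" "Ck_on k f S"
  shows "Ck_on k g S"
  using assms(2,3)
proof (induction k arbitrary: f g)
  case 0
  then show ?case by (simp cong: continuous_on_cong)
next
  case (Suc k)
  have D: "(g has_derivative frechet_derivative f (at x)) (at x)" if "x \<in> S" for x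
    using Suc.prems assms(1) that
    by (metis Ck_on.simps(2) frechet_derivative_works has_derivative_transform_within_open)
  then have "frechet_derivative f (at x) = frechet_derivative g (at x)" if "x \<in> S" for x
    using frechet_derivative_at that by blast
  then have "Ck_on k (\<lambda>x. frechet_derivative g (at x) v) S" for v
    using Suc.IH[of "\<lambda>x. frechet_derivative f (at x) v" "\<lambda>x. frechet_derivative g (at x) v"]
      Suc.prems by simp
  then show ?case using D by (auto simp: differentiable_def)
qed

lemma Ck_on_Suc_imp: "Ck_on (Suc k) f S \<Longrightarrow> Ck_on k f S"
proof (induction k arbitrary: f)
  case 0
  then show ?case
    by (auto intro!: differentiable_imp_continuous_on
        simp: differentiable_on_def differentiable_at_withinI)
next
  case (Suc k)
  then show ?case by (metis Ck_on.simps(2))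
qed

lemma Ck_on_const: "Ck_on k (\<lambda>x. c) S"
  by (induction k arbitrary: c) auto

lemma Ck_on_add:
  assumes "open S" "Ck_on k f S" "Ck_on k g S"
  shows "Ck_on k (\<lambda>x. f x + g x) S"
  using assms(2,3)
proof (induction k arbitrary: f g)
  case 0
  then show ?case by (auto intro: continuous_on_add)
next
  case (Suc k)
  have D: "((\<lambda>x. f x + g x) has_derivative
      (\<lambda>v. frechet_derivative f (at x) v + frechet_derivative g (at x) v)) (at x)"
    if "x \<in> S" for x
    using Suc.prems that by (intro has_derivative_add) (auto simp flip: frechet_derivative_works)
  have "Ck_on k (\<lambda>x. frechet_derivative (\<lambda>x. f x + g x) (at x) v) S" for v
    by (rule Ck_on_cong[OF assms(1) _ Suc.IH[of "\<lambda>x. frechet_derivative f (at x) v"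
            "\<lambda>x. frechet_derivative g (at x) v"]])
      (use Suc.prems in \<open>auto simp flip: frechet_derivative_at[OF D]\<close>)
  then show ?case using D by (auto simp: differentiable_def)
qed

lemma Ck_on_mult:
  assumes "open S" "Ck_on k f S" "Ck_on k g S"
  shows "Ck_on k (\<lambda>x. f x * g x) S"
  using assms(2,3)
proof (induction k arbitrary: f g)
  case 0
  then show ?case by (auto intro: continuous_on_mult)
next
  case (Suc k)
  have D: "((\<lambda>x. f x * g x) has_derivative
      (\<lambda>v. f x * frechet_derivative g (at x) v + frechet_derivative f (at x) v * g x)) (at x)"
    if "x \<in> S" for x
    using Suc.prems that by (intro has_derivative_mult) (auto simp flip: frechet_derivative_works)
  have "Ck_on k (\<lambda>x. frechet_derivative (\<lambda>x. f x * g x) (at x) v) S" for v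
    by (rule Ck_on_cong[OF assms(1) _ Ck_on_add[OF assms(1)
          Suc.IH[of f "\<lambda>x. frechet_derivative g (at x) v"]
          Suc.IH[of "\<lambda>x. frechet_derivative f (at x) v" g]]])
      (use Suc.prems Ck_on_Suc_imp in \<open>auto simp flip: frechet_derivative_at[OF D]\<close>)
  then show ?case using D by (auto simp: differentiable_def)
qed

lemma smooth_traj_const: "smooth_traj (\<lambda>x. c)"
  by (simp add: smooth_traj_def Cinf_on_def Ck_on_const o_def)

lemma smooth_traj_add: "smooth_traj f \<Longrightarrow> smooth_traj g \<Longrightarrow> smooth_traj (\<lambda>x. f x + g x)"
  by (simp add: smooth_traj_def Cinf_on_def Ck_on_add open_G_curv o_def)

lemma smooth_traj_mult: "smooth_traj f \<Longrightarrow> smooth_traj g \<Longrightarrow> smooth_traj (\<lambda>x. f x * g x)"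
  by (simp add: smooth_traj_def Cinf_on_def Ck_on_mult open_G_curv o_def)

lemma Dproj_tangent:
  assumes "\<gamma> \<in> G_curv"
  shows "Dproj \<gamma> \<xi> \<in> tangent_space (proj \<gamma>)"
proof -
  have D: "((\<lambda>x. f (proj x)) has_derivative frechet_derivative (\<lambda>x. f (proj x)) (at \<gamma>)) (at \<gamma>)"
    if "smooth_traj f" for f
    using smooth_traj_differentiable[OF that assms] by (simp add: frechet_derivative_works o_def)
  show ?thesis
    unfolding tangent_space_def
  proof (intro CollectI conjI allI impI)
    fix f g assume fg: "smooth_traj f" "smooth_traj g"
    show "Dproj \<gamma> \<xi> (\<lambda>x. f x + g x) = Dproj \<gamma> \<xi> f + Dproj \<gamma> \<xi> g"
      using fg frechet_derivative_at[OF has_derivative_add[OF D[OF fg(1)] D[OF fg(2)]], symmetric]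
      by (simp add: Dproj_def smooth_traj_add o_def)
    show "Dproj \<gamma> \<xi> (\<lambda>x. f x * g x) = f (proj \<gamma>) * Dproj \<gamma> \<xi> g + g (proj \<gamma>) * Dproj \<gamma> \<xi> f"
      using fg frechet_derivative_at[OF has_derivative_mult[OF D[OF fg(1)] D[OF fg(2)]], symmetric]
      by (simp add: Dproj_def smooth_traj_mult o_def)
  next
    fix c :: real and f assume f: "smooth_traj f"
    show "Dproj \<gamma> \<xi> (\<lambda>x. c * f x) = c * Dproj \<gamma> \<xi> f"
      using f frechet_derivative_at[OF has_derivative_mult_right[OF D[OF f]], symmetric]
      by (simp add: Dproj_def smooth_traj_mult smooth_traj_const o_def)
  qed (simp add: Dproj_def)
qed

lemma Dproj_add:
  assumes "\<gamma> \<in> G_curv"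
  shows "Dproj \<gamma> (\<xi> + \<eta>) = (\<lambda>f. Dproj \<gamma> \<xi> f + Dproj \<gamma> \<eta> f)"
  using linear_frechet_derivative[OF smooth_traj_differentiable[OF _ assms]]
  by (auto simp: Dproj_def linear_add)

lemma Dproj_scale:
  assumes "\<gamma> \<in> G_curv"
  shows "Dproj \<gamma> (c *\<^sub>R \<xi>) = (\<lambda>f. c * Dproj \<gamma> \<xi> f)"
  using linear_frechet_derivative[OF smooth_traj_differentiable[OF _ assms]]
  by (auto simp: Dproj_def linear_scale)

lemma linear_pullback:
  assumes "\<gamma> \<in> G_curv" "\<alpha> \<in> cotangent_space (proj \<gamma>)"
  shows "linear (\<alpha> \<circ> Dproj \<gamma>)"
  using assms Dproj_tangent[OF assms(1)]
  by (intro linearI) (auto simp: Dproj_add Dproj_scale cotangent_space_def)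

lemma omega_omega_inv: "linear \<alpha> \<Longrightarrow> omega (omega_inv \<alpha>) \<eta> = \<alpha> \<eta>"
  using bij_betw_inv_into_right[OF bij_omega_flat, of \<alpha>]
  by (simp add: omega_inv_def) (metis omega_flat_def)

lemma omega_inv_eqI: "(\<And>\<eta>. omega \<xi> \<eta> = \<alpha> \<eta>) \<Longrightarrow> omega_inv \<alpha> = \<xi>"
  using bij_betw_inv_into_left[OF bij_omega_flat, of \<xi>]
  by (simp add: omega_inv_def omega_flat_def)

lemma push_tensor_act:
  assumes "(a, b) \<in> Aff_pos" "\<gamma> \<in> G_curv"
  shows "push_tensor (act (a, b) \<gamma>) c = push_tensor \<gamma> (c / a)"
proof -
  let ?h = "(a, b)"
  have a: "a > 0" using assms by (simp add: Aff_pos_def)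
  have \<gamma>': "act ?h \<gamma> \<in> G_curv" using act_in_G_curv assms by blast
  have "c * Dproj (act ?h \<gamma>) (omega_inv (\<alpha> \<circ> Dproj (act ?h \<gamma>))) f
      = c / a * Dproj \<gamma> (omega_inv (\<alpha> \<circ> Dproj \<gamma>)) f"
    if \<alpha>: "\<alpha> \<in> cotangent_space (proj \<gamma>)" for \<alpha> f
  proof -
    let ?\<beta> = "\<alpha> \<circ> Dproj \<gamma>"
    have lin: "linear ?\<beta>" using linear_pullback assms(2) \<alpha> by blast
    have "omega_inv (\<alpha> \<circ> Dproj (act ?h \<gamma>)) = act ?h ((1 / a) *\<^sub>R omega_inv ?\<beta>)"
    proof (rule omega_inv_eqI)
      fix \<eta> :: phase
      obtain x v where \<eta>: "\<eta> = (x, v)" by (cases \<eta>)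
      define \<zeta> where "\<zeta> = (x - (b / a) *\<^sub>R v, (1 / a) *\<^sub>R v)"
      have \<zeta>: "\<eta> = act ?h \<zeta>" using a by (simp add: \<eta> \<zeta>_def)
      have "omega (act ?h ((1 / a) *\<^sub>R omega_inv ?\<beta>)) \<eta> = a * omega ((1 / a) *\<^sub>R omega_inv ?\<beta>) \<zeta>"
        unfolding \<zeta> by (rule omega_act) simp
      also have "\<dots> = omega (omega_inv ?\<beta>) \<zeta>"
        using a by (cases "omega_inv ?\<beta>"; cases \<zeta>) (simp add: field_simps)
      also have "\<dots> = ?\<beta> \<zeta>" by (rule omega_omega_inv[OF lin])
      also have "\<dots> = (\<alpha> \<circ> Dproj (act ?h \<gamma>)) \<eta>"
        by (simp add: \<zeta> Dproj_act[OF assms] del: act.simps)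
      finally show "omega (act ?h ((1 / a) *\<^sub>R omega_inv ?\<beta>)) \<eta> = (\<alpha> \<circ> Dproj (act ?h \<gamma>)) \<eta>" .
    qed
    then show ?thesis
      by (simp add: Dproj_act[OF assms] Dproj_scale[OF assms(2)])
  qed
  then show ?thesis
    by (auto simp: push_tensor_def proj_act[OF assms(1)] intro!: restrict_ext)
qed

lemma sigma_traj_proj:
  assumes "\<gamma> \<in> G_curv"
  shows "sigma_traj (proj \<gamma>) = {push_tensor \<gamma> c | c. c > 0}"
proof
  show "{push_tensor \<gamma> c | c. c > 0} \<subseteq> sigma_traj (proj \<gamma>)"
    unfolding sigma_traj_def using assms by blast
  show "sigma_traj (proj \<gamma>) \<subseteq> {push_tensor \<gamma> c | c. c > 0}"
  proof
    fix P assume "P \<in> sigma_traj (proj \<gamma>)"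
    then obtain \<gamma>' c where P: "P = push_tensor \<gamma>' c" "c > 0" "\<gamma>' \<in> G_curv" "proj \<gamma>' = proj \<gamma>"
      by (auto simp: sigma_traj_def)
    then obtain a b where "(a, b) \<in> Aff_pos" "\<gamma>' = act (a, b) \<gamma>"
      using proj_eq_iff[OF assms P(3)] by (metis surj_pair)
    then have "P = push_tensor \<gamma> (c / a)" "c / a > 0"
      using P push_tensor_act[OF _ assms] by (auto simp: Aff_pos_def simp del: act.simps)
    then show "P \<in> {push_tensor \<gamma> c | c. c > 0}" by blast
  qed
qed

lemma sigma_traj_nonempty: "sigma_traj \<tau> \<noteq> {}"
  using ex_proj[of \<tau>] sigma_traj_proj zero_less_one by blast

end

theory Submission
  imports Defs
begin

text \<open>
  Fix \<open>\<gamma>\<close> over \<open>\<tau>\<close>. The equality amounts to two facts about \<open>Dproj \<gamma>\<close>, which together say that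
  the pullbacks \<open>\<alpha> \<circ> Dproj \<gamma>\<close> of covectors at \<open>\<tau>\<close> are exactly the linear forms that vanish on
  the tangent space of the orbit, i.e. the image of \<open>F_curv \<gamma>\<close> under \<open>omega_flat\<close>.

  A smooth function on the quotient pulls back to a function that is constant on orbits, so
  \<open>Dproj \<gamma>\<close> annihilates \<open>orbit_tangent \<gamma>\<close> (\<open>Dproj_orbit_tangent\<close>) and pullbacks of covectors
  vanish there. Hence \<open>\<sigma>\<^sub>\<tau>\<close> takes its values in \<open>\<F>\<^sub>\<tau>\<close>.

  Conversely, a linear form \<open>\<beta>\<close> that vanishes on the orbit directions has to be descended to a
  covector, defined on all derivations at \<open>\<tau>\<close> and not just on those in the range of \<open>Dproj \<gamma>\<close>. Every
  smooth function \<open>f\<close> on the quotient gives such a covector \<open>D \<mapsto> D f\<close>, and its pullback is the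
  differential of \<open>f \<circ> proj\<close> at \<open>\<gamma>\<close>. So it suffices to write \<open>\<beta>\<close> as the differential at \<open>\<gamma>\<close> of an
  invariant smooth function on \<open>G_curv\<close>; an explicit rational one is \<open>descended_form\<close>.
\<close>

section \<open>Calculus of smooth functions\<close>

lemma Ck_on_inner_left: "Ck_on k (\<lambda>x. w \<bullet> x) S"
proof (cases k)
  case (Suc m)
  have "((\<lambda>x. w \<bullet> x) has_derivative (\<lambda>v. w \<bullet> v)) (at x)" for x
    by (auto intro!: derivative_eq_intros)
  note D = this frechet_derivative_at[OF this, symmetric]
  show ?thesis unfolding Suc using D(1) by (auto simp: D(2) Ck_on_const differentiable_def)
qed (auto intro!: continuous_intros)

lemma Ck_on_sum:
  assumes "open S" "\<And>i. i \<in> I \<Longrightarrow> Ck_on k (f i) S"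
  shows "Ck_on k (\<lambda>x. \<Sum>i\<in>I. f i x) S"
  using assms(2)
  by (induction I rule: infinite_finite_induct) (auto intro!: Ck_on_add Ck_on_const assms(1))

lemma Ck_on_diff:
  assumes "open S" "Ck_on k f S" "Ck_on k g S"
  shows "Ck_on k (\<lambda>x. f x - g x) S"
  using Ck_on_add[OF assms(1,2) Ck_on_mult[OF assms(1) Ck_on_const[of k "-1"] assms(3)]] by simp

text \<open>The derivative \<open>- g' / g\<^sup>2\<close> is a product of \<open>g'\<close> with copies of \<open>1 / g\<close>, to which the
  induction hypothesis applies.\<close>

lemma Ck_on_inverse:
  assumes "open S" "Ck_on k g S" "\<And>x. x \<in> S \<Longrightarrow> g x \<noteq> 0"
  shows "Ck_on k (\<lambda>x. inverse (g x)) S"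
  using assms(2)
proof (induction k)
  case 0
  then show ?case using assms(3) by (auto intro!: continuous_intros)
next
  case (Suc k)
  have D: "((\<lambda>x. inverse (g x)) has_derivative
      (\<lambda>v. - (inverse (g x) * frechet_derivative g (at x) v * inverse (g x)))) (at x)"
    if "x \<in> S" for x
    using Suc.prems assms(3) that
    by (intro Deriv.has_derivative_inverse) (auto simp flip: frechet_derivative_works)
  have IH: "Ck_on k (\<lambda>x. inverse (g x)) S"
    using Suc.IH Suc.prems Ck_on_Suc_imp by blast
  have "Ck_on k (\<lambda>x. frechet_derivative (\<lambda>x. inverse (g x)) (at x) v) S" for v
  proof (rule Ck_on_cong[OF assms(1)])
    show "Ck_on k (\<lambda>x. (-1) * (inverse (g x) * frechet_derivative g (at x) v * inverse (g x))) S"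
      using Suc.prems by (intro Ck_on_mult assms(1) Ck_on_const IH) simp
    show "(-1) * (inverse (g x) * frechet_derivative g (at x) v * inverse (g x))
        = frechet_derivative (\<lambda>x. inverse (g x)) (at x) v" if "x \<in> S" for x
      using fun_cong[OF frechet_derivative_at[OF D[OF that]], of v] by linarith
  qed
  then show ?case using D by (auto simp: differentiable_def)
qed

section \<open>The kernel of the differential of the projection\<close>

lemma has_derivative_orbit_map:
  "((\<lambda>h. act h \<gamma>) has_derivative frechet_derivative (\<lambda>h. act h \<gamma>) (at (1, 0))) (at (1, 0))"
proof -
  obtain X V where \<gamma>: "\<gamma> = (X, V)" by (cases \<gamma>)
  have "(\<lambda>h. act h \<gamma>) = (\<lambda>h. (X + snd h *\<^sub>R V, fst h *\<^sub>R V))"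
    unfolding \<gamma> by (intro ext) (metis act.simps prod.collapse)
  moreover have "((\<lambda>h. (X + snd h *\<^sub>R V, fst h *\<^sub>R V)) has_derivative
      (\<lambda>h. (snd h *\<^sub>R V, fst h *\<^sub>R V))) (at (1 :: real, 0 :: real))"
    by (auto intro!: derivative_eq_intros)
  ultimately have "(\<lambda>h. act h \<gamma>) differentiable at (1, 0)"
    unfolding differentiable_def by auto
  then show ?thesis by (simp add: frechet_derivative_works)
qed

lemma open_Aff_pos: "open Aff_pos"
proof -
  have "Aff_pos = {0<..} \<times> UNIV" by (auto simp: Aff_pos_def)
  moreover have "open ({0 :: real<..} \<times> (UNIV :: real set))" by (intro open_Times) auto
  ultimately show ?thesis by metis
qed

text \<open>Chain rule along the orbit map, on which functions pulled back from the quotient are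
  constant.\<close>

lemma Dproj_orbit_tangent:
  assumes "\<gamma> \<in> G_curv" "\<eta> \<in> orbit_tangent \<gamma>"
  shows "Dproj \<gamma> \<eta> = (\<lambda>f. 0)"
proof
  fix f
  show "Dproj \<gamma> \<eta> f = 0"
  proof (cases "smooth_traj f")
    case True
    let ?A = "frechet_derivative (\<lambda>h. act h \<gamma>) (at (1, 0))"
    let ?D = "frechet_derivative (f \<circ> proj) (at \<gamma>)"
    obtain k where k: "\<eta> = ?A k" using assms(2) by (auto simp: orbit_tangent_def)
    have unit: "act (1, 0) \<gamma> = \<gamma>" by (cases \<gamma>) simp
    have "((f \<circ> proj) has_derivative ?D) (at (act (1, 0) \<gamma>))"
      using smooth_traj_differentiable[OF True assms(1)]
      by (simp add: unit frechet_derivative_works)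
    from diff_chain_at[OF has_derivative_orbit_map this]
    have "((f \<circ> proj) \<circ> (\<lambda>h. act h \<gamma>) has_derivative ?D \<circ> ?A) (at (1, 0))" .
    moreover have "((f \<circ> proj) \<circ> (\<lambda>h. act h \<gamma>) has_derivative (\<lambda>_. 0)) (at (1, 0))"
    proof (rule has_derivative_transform_within_open[OF has_derivative_const open_Aff_pos])
      show "(1, 0) \<in> Aff_pos" by (simp add: Aff_pos_def)
      show "f (proj \<gamma>) = ((f \<circ> proj) \<circ> (\<lambda>h. act h \<gamma>)) h" if "h \<in> Aff_pos" for h
        using that by (simp add: proj_act)
    qed
    ultimately have "?D \<circ> ?A = (\<lambda>_. 0)" by (rule has_derivative_unique)
    then have "?D \<eta> = 0" using k by (metis comp_apply)
    then show ?thesis using True by (simp add: Dproj_def)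
  qed (simp add: Dproj_def)
qed

lemma push_tensor_in_F_traj:
  assumes "\<gamma> \<in> G_curv" "\<alpha> \<in> cotangent_space (proj \<gamma>)"
  shows "push_tensor \<gamma> c \<alpha> \<in> F_traj (proj \<gamma>)"
proof -
  let ?\<xi> = "omega_inv (\<alpha> \<circ> Dproj \<gamma>)"
  have lin: "linear (\<alpha> \<circ> Dproj \<gamma>)" by (rule linear_pullback[OF assms])
  have "omega (c *\<^sub>R ?\<xi>) \<eta> = 0" if \<eta>: "\<eta> \<in> orbit_tangent \<gamma>" for \<eta>
  proof -
    have "Dproj \<gamma> \<eta> = Dproj \<gamma> 0"
      using Dproj_orbit_tangent[OF assms(1) \<eta>] Dproj_scale[OF assms(1), of 0 0] by simp
    then have "omega ?\<xi> \<eta> = 0"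
      using linear_0[OF lin] by (simp add: omega_omega_inv[OF lin])
    then show ?thesis
      by (cases ?\<xi>; cases \<eta>) (simp flip: right_diff_distrib)
  qed
  then have "c *\<^sub>R ?\<xi> \<in> F_curv \<gamma>" by (simp add: F_curv_def)
  moreover have "push_tensor \<gamma> c \<alpha> = Dproj \<gamma> (c *\<^sub>R ?\<xi>)"
    using assms by (simp add: push_tensor_def Dproj_scale)
  ultimately show ?thesis by (simp add: F_traj_proj[OF assms(1)])
qed

section \<open>Descending linear forms to the quotient\<close>

lemma smooth_traj_of_invariant:
  assumes "Cinf_on \<phi> G_curv"
    and inv: "\<And>h \<gamma>. h \<in> Aff_pos \<Longrightarrow> \<gamma> \<in> G_curv \<Longrightarrow> \<phi> (act h \<gamma>) = \<phi> \<gamma>"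
  obtains f where "smooth_traj f" "\<And>\<gamma>. \<gamma> \<in> G_curv \<Longrightarrow> f (proj \<gamma>) = \<phi> \<gamma>"
proof -
  define f where "f \<tau> = \<phi> (SOME \<gamma>. \<gamma> \<in> G_curv \<and> proj \<gamma> = \<tau>)" for \<tau>
  have f: "f (proj \<gamma>) = \<phi> \<gamma>" if \<gamma>: "\<gamma> \<in> G_curv" for \<gamma>
  proof -
    define \<gamma>' where "\<gamma>' = (SOME \<gamma>'. \<gamma>' \<in> G_curv \<and> proj \<gamma>' = proj \<gamma>)"
    have "\<gamma>' \<in> G_curv \<and> proj \<gamma>' = proj \<gamma>"
      unfolding \<gamma>'_def by (rule someI[of _ \<gamma>]) (use \<gamma> in simp)
    then obtain h where "h \<in> Aff_pos" "\<gamma>' = act h \<gamma>"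
      using proj_eq_iff[OF \<gamma>] by metis
    then show ?thesis using inv[OF _ \<gamma>] by (simp add: f_def \<gamma>'_def)
  qed
  have "Cinf_on (f \<circ> proj) G_curv"
    unfolding Cinf_on_def
  proof
    fix k
    show "Ck_on k (f \<circ> proj) G_curv"
      by (rule Ck_on_cong[OF open_G_curv, of \<phi>]) (use assms(1) f in \<open>auto simp: Cinf_on_def\<close>)
  qed
  then show ?thesis using that f by (simp add: smooth_traj_def)
qed

text \<open>Write \<open>\<gamma> = (X, V)\<close>, \<open>w = (A, B)\<close> with \<open>A\<close> and \<open>B\<close> orthogonal to \<open>V\<close>, and \<open>p = (Y, W)\<close>.
  The component of \<open>Y - X\<close> orthogonal to \<open>W\<close>, for the Euclidean inner product, is invariant
  under \<open>Y \<mapsto> Y + b W\<close> and \<open>W \<mapsto> a W\<close>; its inner product with \<open>A\<close> contributes \<open>A \<bullet> dX\<close> to the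
  differential at \<open>\<gamma>\<close>. The remaining term is homogeneous of degree \<open>0\<close> in \<open>W\<close> and contributes
  \<open>B \<bullet> dV\<close>; the factor \<open>V \<bullet> W\<close> makes it rational, whereas \<open>(B \<bullet> W) / norm W\<close> would require a
  square root.\<close>

definition descended_form :: "phase \<Rightarrow> phase \<Rightarrow> phase \<Rightarrow> real" where
  "descended_form \<gamma> w = (\<lambda>p.
     fst w \<bullet> (fst p - fst \<gamma>) +
     ((snd w \<bullet> snd p) * (snd \<gamma> \<bullet> snd p) - ((fst p - fst \<gamma>) \<bullet> snd p) * (fst w \<bullet> snd p))
       * inverse (snd p \<bullet> snd p))"

lemma descended_form_act:
  assumes "h \<in> Aff_pos" "p \<in> G_curv"
  shows "descended_form \<gamma> w (act h p) = descended_form \<gamma> w p"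
proof -
  obtain a b where h: "h = (a, b)" by (cases h)
  obtain Y W where p: "p = (Y, W)" by (cases p)
  have a: "a > 0" and W: "W \<bullet> W \<noteq> 0" using assms by (auto simp: h p Aff_pos_def G_curv_def)
  have [simp]: "u \<bullet> (Y + b *\<^sub>R W - fst \<gamma>) = u \<bullet> (Y - fst \<gamma>) + b * (u \<bullet> W)"
    "(Y + b *\<^sub>R W - fst \<gamma>) \<bullet> u = (Y - fst \<gamma>) \<bullet> u + b * (W \<bullet> u)" for u
    by (simp_all add: inner_diff_left inner_diff_right inner_add_left inner_add_right)
  show ?thesis
    using a W by (simp add: descended_form_def h p inner_add_left inner_add_right field_simps)
qed

lemma Cinf_on_descended_form: "Cinf_on (descended_form \<gamma> w) G_curv"
proof -
  note ck = Ck_on_add Ck_on_mult Ck_on_diff Ck_on_const Ck_on_inner_left open_G_curv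
  have fst_ck: "Ck_on k (\<lambda>p. u \<bullet> (fst p - fst \<gamma>)) G_curv" for k u
  proof -
    have "(\<lambda>p. u \<bullet> (fst p - fst \<gamma>)) = (\<lambda>p. (u, 0 :: real ^ 4) \<bullet> p - u \<bullet> fst \<gamma>)"
      by (auto simp: inner_diff_right)
    then show ?thesis by (auto intro!: ck)
  qed
  have snd_ck: "Ck_on k (\<lambda>p. u \<bullet> snd p) G_curv" for k and u :: "real ^ 4"
  proof -
    have "(\<lambda>p. u \<bullet> snd p) = (\<lambda>p. (0 :: real ^ 4, u) \<bullet> p)" by auto
    then show ?thesis by (auto intro!: ck)
  qed
  have "Ck_on k (\<lambda>p. snd p \<bullet> snd p) G_curv" for k
    unfolding euclidean_inner[of "snd _" "snd _"]
    by (simp only: inner_commute[of "snd _"], intro Ck_on_sum ck snd_ck)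
  then have inv_ck: "Ck_on k (\<lambda>p. inverse (snd p \<bullet> snd p)) G_curv" for k
    by (rule Ck_on_inverse[OF open_G_curv]) (auto simp: G_curv_def)
  have "Ck_on k (\<lambda>p. (fst p - fst \<gamma>) \<bullet> snd p) G_curv" for k
    unfolding euclidean_inner[of "_ - _" "snd _"]
    by (simp only: inner_commute[of "snd _"] inner_commute[of "_ - _"],
        intro Ck_on_sum ck snd_ck fst_ck)
  then show ?thesis
    unfolding Cinf_on_def descended_form_def by (intro allI ck fst_ck snd_ck inv_ck)
qed

text \<open>At \<open>\<gamma>\<close> each of the products in the numerator of the quotient has a factor that vanishes, so
  that the derivative of the denominator does not contribute.\<close>

lemma has_derivative_descended_form:
  assumes "\<gamma> \<in> G_curv" "fst w \<bullet> snd \<gamma> = 0" "snd w \<bullet> snd \<gamma> = 0"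
  shows "(descended_form \<gamma> w has_derivative (\<lambda>\<eta>. w \<bullet> \<eta>)) (at \<gamma>)"
proof -
  have V: "snd \<gamma> \<bullet> snd \<gamma> \<noteq> 0" using assms(1) by (auto simp: G_curv_def)
  show ?thesis
    unfolding descended_form_def
    by (rule derivative_eq_intros refl V)+ (use V assms(2,3) in \<open>auto simp: inner_prod_def\<close>)
qed

text \<open>Representing \<open>\<beta>\<close> by a vector \<open>(A, B)\<close>, the two orbit directions \<open>(V, 0)\<close> and \<open>(0, V)\<close> give the
  two orthogonality conditions on \<open>A\<close> and \<open>B\<close>.\<close>

lemma ex_smooth_traj_differential:
  assumes "\<gamma> \<in> G_curv" "linear \<beta>" and vanish: "\<And>\<eta>. \<eta> \<in> orbit_tangent \<gamma> \<Longrightarrow> \<beta> \<eta> = 0"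
  obtains f where "smooth_traj f" "\<And>\<eta>. Dproj \<gamma> \<eta> f = \<beta> \<eta>"
proof -
  define w where "w = adjoint \<beta> 1"
  have w: "\<beta> \<eta> = w \<bullet> \<eta>" for \<eta>
    using adjoint_works[OF assms(2), of \<eta> 1] by (simp add: w_def inner_commute)
  obtain X V where \<gamma>: "\<gamma> = (X, V)" by (cases \<gamma>)
  have "(V, 0) \<in> orbit_tangent \<gamma>" "(0, V) \<in> orbit_tangent \<gamma>"
    unfolding \<gamma> orbit_tangent_eq
    by (auto intro: image_eqI[of _ _ "(0, 1)"] image_eqI[of _ _ "(1, 0)"])
  then have "fst w \<bullet> snd \<gamma> = 0" "snd w \<bullet> snd \<gamma> = 0"
    using vanish[of "(V, 0)"] vanish[of "(0, V)"] by (simp_all add: w \<gamma> inner_prod_def)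
  note D = has_derivative_descended_form[OF assms(1) this]
  obtain f where f: "smooth_traj f" "\<And>p. p \<in> G_curv \<Longrightarrow> f (proj p) = descended_form \<gamma> w p"
    using smooth_traj_of_invariant[OF Cinf_on_descended_form descended_form_act] by metis
  have "((f \<circ> proj) has_derivative (\<lambda>\<eta>. w \<bullet> \<eta>)) (at \<gamma>)"
    by (rule has_derivative_transform_within_open[OF D open_G_curv assms(1)]) (simp add: f(2))
  from frechet_derivative_at[OF this] have "Dproj \<gamma> \<eta> f = \<beta> \<eta>" for \<eta>
    using f(1) by (simp add: Dproj_def w)
  then show ?thesis using that f(1) by blast
qed

lemma eval_in_cotangent_space:
  assumes "smooth_traj f"
  shows "(\<lambda>D. if D \<in> tangent_space \<tau> then D f else 0) \<in> cotangent_space \<tau>"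
proof -
  have "(\<lambda>g. D g + E g) \<in> tangent_space \<tau>"
    if "D \<in> tangent_space \<tau>" "E \<in> tangent_space \<tau>" for D E
    using that by (simp add: tangent_space_def algebra_simps)
  moreover have "(\<lambda>g. c * D g) \<in> tangent_space \<tau>" if "D \<in> tangent_space \<tau>" for c D
    using that by (simp add: tangent_space_def algebra_simps)
  ultimately show ?thesis by (simp add: cotangent_space_def)
qed

lemma ex_covector_pullback:
  assumes "\<gamma> \<in> G_curv" "linear \<beta>" "\<And>\<eta>. \<eta> \<in> orbit_tangent \<gamma> \<Longrightarrow> \<beta> \<eta> = 0"
  shows "\<exists>\<alpha>\<in>cotangent_space (proj \<gamma>). \<alpha> \<circ> Dproj \<gamma> = \<beta>"
proof -
  obtain f where f: "smooth_traj f" "\<And>\<eta>. Dproj \<gamma> \<eta> f = \<beta> \<eta>"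
    using ex_smooth_traj_differential[OF assms] by blast
  show ?thesis
    by (rule bexI[OF _ eval_in_cotangent_space[OF f(1)]])
      (auto simp: f(2) Dproj_tangent[OF assms(1)])
qed

text \<open>The vector \<open>\<xi> / c\<close> corresponds under \<open>omega_flat\<close> to a form that descends to a covector, and
  the factor \<open>c\<close> of the tensor restores \<open>\<xi>\<close>.\<close>

lemma F_traj_subset_push_tensor:
  assumes "\<gamma> \<in> G_curv" "c \<noteq> 0"
  shows "F_traj (proj \<gamma>) \<subseteq> push_tensor \<gamma> c ` cotangent_space (proj \<gamma>)"
proof
  fix D assume "D \<in> F_traj (proj \<gamma>)"
  then obtain \<xi> where \<xi>: "\<xi> \<in> F_curv \<gamma>" "D = Dproj \<gamma> \<xi>"
    by (auto simp: F_traj_proj[OF assms(1)])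
  define \<zeta> where "\<zeta> = (1 / c) *\<^sub>R \<xi>"
  have "linear (omega_flat \<zeta>)" using bij_betw_apply[OF bij_omega_flat, of \<zeta>] by simp
  moreover have "omega_flat \<zeta> \<eta> = 0" if "\<eta> \<in> orbit_tangent \<gamma>" for \<eta>
  proof -
    have "omega \<xi> \<eta> = 0" using \<xi>(1) that by (simp add: F_curv_def)
    then show ?thesis
      by (cases \<xi>; cases \<eta>) (simp add: omega_flat_def \<zeta>_def)
  qed
  ultimately obtain \<alpha> where \<alpha>: "\<alpha> \<in> cotangent_space (proj \<gamma>)" "\<alpha> \<circ> Dproj \<gamma> = omega_flat \<zeta>"
    using ex_covector_pullback[OF assms(1)] by blast
  have "omega_inv (\<alpha> \<circ> Dproj \<gamma>) = \<zeta>"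
    by (rule omega_inv_eqI) (simp add: \<alpha>(2) omega_flat_def)
  then have "push_tensor \<gamma> c \<alpha> = Dproj \<gamma> (c *\<^sub>R \<zeta>)"
    using \<alpha>(1) assms(1) by (simp add: push_tensor_def Dproj_scale)
  also have "\<dots> = D" using assms(2) by (simp add: \<zeta>_def \<xi>(2))
  finally show "D \<in> push_tensor \<gamma> c ` cotangent_space (proj \<gamma>)" using \<alpha>(1) by blast
qed

section \<open>The distribution as the image of the conformal co-symplectic structure\<close>

theorem mainTheorem2:
  fixes \<tau> :: traj
  shows "\<forall>P\<in>sigma_traj \<tau>. F_traj \<tau> = P ` cotangent_space \<tau>"
proof
  fix P assume "P \<in> sigma_traj \<tau>"
  then obtain \<gamma> c where "\<gamma> \<in> G_curv" "proj \<gamma> = \<tau>" "c > 0" "P = push_tensor \<gamma> c"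
    by (auto simp: sigma_traj_def)
  then show "F_traj \<tau> = P ` cotangent_space \<tau>"
    using F_traj_subset_push_tensor[of \<gamma> c] push_tensor_in_F_traj[of \<gamma> _ c] by auto
qed

end
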